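(* Let $B$, $\Omega$ be the $N\times N$ matrices ($N=(h+1)K$) of the systems form $x=Bx+\Omega\varepsilon$ of a structural VARMA model satisfying the standing assumptions in the context, let $\mathcal{G}(B,\Omega)$ be the induced graph, and let $\Phi=(I-B)^{-1}\Omega$. Fix $i\in\{1,\dots,K\}$, $j\in\{1,\dots,N\}$ and a shock size $\xi\in\mathbb{R}$. Let $\mathbf{1}_{\eta(j)}$ be the $\eta(j)$-dimensional vector of ones, let $P^{(1)}_{\varepsilon_i,x_j},\dots,P^{(k)}_{\varepsilon_i,x_j}$ be a partition of $\mathcal{P}_{\varepsilon_i,x_j}$, and let $e_1,\dots,e_k\in\{0,\xi\}^{\eta(j)}$ satisfy $\sum_{m=1}^k e_m=\xi\mathbf{1}_{\eta(j)}$. Then (i) $\mathcal{Q}_\xi(\mathcal{P}_{\varepsilon_i,x_j})=\mathcal{C}_{\varepsilon_i,x_j}(\xi\mathbf{1}_{\eta(j)})=\xi\,\Phi_{j,i}$; (ii) $\sum_{m=1}^k\mathcal{Q}_\xi(P^{(m)}_{\varepsilon_i,x_j})=\xi\,\Phi_{j,i}$; (iii) $\sum_{m=1}^k\mathcal{C}_{\varepsilon_i,x_j}(e_m)=\xi\,\Phi_{j,i}$.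
   Context: Model. Let $K\ge1$, $\ell,q,h\ge0$ be integers. $y_t$ is a $K$-dimensional stationary process satisfying the structural VARMA equation $A_0y_t=\sum_{i=1}^{\ell}A_iy_{t-i}+\sum_{j=1}^{q}\Psi_j\varepsilon_{t-j}+\varepsilon_t$ with real $K\times K$ matrices. Standing assumptions: $E[\varepsilon_t]=0$, $E[\varepsilon_t\varepsilon_t']=I$, $E[\varepsilon_t\varepsilon_{t-r}']=O$ for all $r\ge1$; $A_0$ is non-singular. $T$ is a fixed $K\times K$ permutation matrix (the transmission matrix). Put $y_t^*=Ty_t$, $A_i^*=A_iT'$ for $i\ge0$, with $A_i^*=O$ for $i>\ell$ and $\Psi_j=O$ for $j>q$. Let $A_0^*=QL$ be the unique QL-decomposition with $Q$ orthogonal and $L$ lower-triangular with positive diagonal, and let $D=\mathrm{diag}(L)^{-1}$ be the inverse of the diagonal part of $L$. Systems form. Let $N=(h+1)K$, $x=(y_t^{*\prime},\dots,y_{t+h}^{*\prime})'$, $\varepsilon=(\varepsilon_t',\dots,\varepsilon_{t+h}')'$. $B$ and $\Omega$ are $N\times N$ matrices made of $K\times K$ blocks indexed by $a,b\in\{0,\dots,h\}$: for $a=b$ the block of $B$ is $I-DL$ and that of $\Omega$ is $DQ'$; for $a>b$ the block of $B$ is $DQ'A^*_{a-b}$ and that of $\Omega$ is $DQ'\Psi_{a-b}$; for $a<b$ both are zero. So $B$ is strictly lower-triangular. The system is $x=Bx+\Omega\varepsilon$ (variables and shocks dated before $t$, being unaffected by shocks at $t$, are dropped). $\Phi=(I-B)^{-1}\Omega$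 is the (structural) impulse response matrix. Graph. $\mathcal{G}(B,\Omega)$ is the directed acyclic graph with nodes $\varepsilon_1,\dots,\varepsilon_K$ (the shocks at time $t$) and $x_1,\dots,x_N$. There is an edge $x_m\to x_n$ iff $B_{n,m}\ne0$, with path coefficient $\omega_{x_m,x_n}=B_{n,m}$, and an edge $\varepsilon_i\to x_n$ iff $\Omega_{n,i}\neq0$, with path coefficient $\omega_{\varepsilon_i,x_n}=\Omega_{n,i}$. $\mathcal{P}_{u,v}$ is the set of all directed paths from node $u$ to node $v$. For shock size $\xi$, the path-specific effect of a path $p$ is $\mathcal{Q}_\xi(p)=\xi\prod_{(u\to v)\in p}\omega_{u,v}$, and the total path-specific effect of a collection $P$ of paths is $\mathcal{Q}_\xi(P)=\sum_{p\in P}\mathcal{Q}_\xi(p)$. Potential outcomes. Fix the shock $\varepsilon_i$. Let $\eta(j)=2^{j-1}$ and $H(j)=2^j-1$ (so $H(0)=0$). A potential outcomes assignment vector for $x_j$ is a vector $\epsilon^{(j)}=(\epsilon_1,\dots,\epsilon_{\eta(j)})$ with all entries in $\{0,\xi\}$. For $k<j$ let $\epsilon^{(j\cdot k)}=(\epsilon^{(j)}_{H(k-1)+1},\dots,\epsilon^{(j)}_{H(k)})$, a vector of length $\eta(k)$. The potential outcome $x_j^*(\epsilon^{(j)})$ is the value of $x_j$ when each nested dependency chain from $x_j$ back to $\varepsilon_i$ experiences its own realisation of $\varepsilon_i$; recursively, $$x_j^*(\epsilon^{(j)})=\sum_{k=1}^{j-1}B_{j,k}\,x_k^*(\epsilon^{(j\cdot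 k)})+\Omega_{j,i}\,\epsilon^{(j)}_{\eta(j)}+\sum_{m\ne i}\Omega_{j,m}\varepsilon_m .$$ The causal effect is $\mathcal{C}_{\varepsilon_i,x_j}(\epsilon^{(j)})=E[x_j^*(\epsilon^{(j)})-x_j^*(0)]$, with $0$ the zero vector of length $\eta(j)$. *)

theory Defs
  imports
    "HOL-Probability.Probability_Measure"
    "Graph_Theory.Digraph"
    "Graph_Theory.Arc_Walk"
    "Jordan_Normal_Form.Gauss_Jordan_Elimination"
begin

unbundle no vec_syntax
no_notation fps_nth (infixl \<open>$\<close> 75)

hide_const (open) Finite_Cartesian_Product.vec Finite_Cartesian_Product.mat
hide_type (open) Finite_Cartesian_Product.vec

section \<open>Matrices\<close>

text \<open>
  Vectors and matrices are those of \<^theory>\<open>Jordan_Normal_Form.Matrix\<close>, whose entries are indexed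
  from 0.  Shocks, variables and the entries of stacked vectors are numbered from 1; the accessors
  below perform the shift.
\<close>

definition entry :: "real mat \<Rightarrow> nat \<Rightarrow> nat \<Rightarrow> real" where
  "entry A m n = A $$ (m - 1, n - 1)"

definition ventry :: "real vec \<Rightarrow> nat \<Rightarrow> real" where
  "ventry v m = v $ (m - 1)"

text \<open>Meaningful for invertible matrices only; \<^const>\<open>mat_inverse\<close> returns \<^const>\<open>None\<close> otherwise.\<close>

definition mat_inv :: "real mat \<Rightarrow> real mat" where
  "mat_inv A = the (mat_inverse A)"

definition permutation_matrix :: "nat \<Rightarrow> real mat \<Rightarrow> bool" where
  "permutation_matrix n T \<longleftrightarrow>
     (\<exists>p. p permutes {..<n} \<and> T = mat n n (\<lambda>(r, c). if c = p r then 1 else 0))"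

text \<open>
  \<^const>\<open>orthogonal_mat\<close> only asks the columns to be pairwise orthogonal and non-isotropic, so
  orthogonality (orthonormal columns) is spelled out here.
\<close>

definition ql_decomposition :: "nat \<Rightarrow> real mat \<Rightarrow> real mat \<Rightarrow> real mat \<Rightarrow> bool" where
  "ql_decomposition n A Q L \<longleftrightarrow>
     Q \<in> carrier_mat n n \<and> L \<in> carrier_mat n n \<and>
     transpose_mat Q * Q = 1\<^sub>m n \<and> Q * transpose_mat Q = 1\<^sub>m n \<and>
     (\<forall>r<n. \<forall>c<n. r < c \<longrightarrow> L $$ (r, c) = 0) \<and>
     (\<forall>r<n. L $$ (r, r) > 0) \<and>
     A = Q * L"

definition diag_part :: "real mat \<Rightarrow> real mat" where
  "diag_part L = mat_diag (dim_row L) (\<lambda>r. L $$ (r, r))"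

text \<open>
  The \<open>(h+1)K \<times> (h+1)K\<close> matrix whose \<open>K \<times> K\<close> block in block position \<open>(a, b)\<close>,
  \<open>a, b \<in> {0..h}\<close>, is \<open>blk a b\<close>.
\<close>

definition block_matrix :: "nat \<Rightarrow> nat \<Rightarrow> (nat \<Rightarrow> nat \<Rightarrow> real mat) \<Rightarrow> real mat" where
  "block_matrix K h blk =
     mat ((h + 1) * K) ((h + 1) * K)
       (\<lambda>(r, c). blk (r div K) (c div K) $$ (r mod K, c mod K))"

section \<open>The structural VARMA model\<close>

definition sq_integrable_rvec :: "'a measure \<Rightarrow> nat \<Rightarrow> ('a \<Rightarrow> real vec) \<Rightarrow> bool" where
  "sq_integrable_rvec M n X \<longleftrightarrow>
     (\<forall>\<omega>\<in>space M. X \<omega> \<in> carrier_vec n) \<and>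
     (\<forall>r<n. (\<lambda>\<omega>. X \<omega> $ r) \<in> borel_measurable M \<and> integrable M (\<lambda>\<omega>. (X \<omega> $ r)\<^sup>2))"

definition mean_vec :: "'a measure \<Rightarrow> nat \<Rightarrow> ('a \<Rightarrow> real vec) \<Rightarrow> real vec" where
  "mean_vec M n X = vec n (\<lambda>r. \<integral>\<omega>. X \<omega> $ r \<partial>M)"

text \<open>\<open>E[X Y']\<close>\<close>

definition cross_moment :: "'a measure \<Rightarrow> nat \<Rightarrow> ('a \<Rightarrow> real vec) \<Rightarrow> ('a \<Rightarrow> real vec) \<Rightarrow> real mat" where
  "cross_moment M n X Y = mat n n (\<lambda>(r, c). \<integral>\<omega>. X \<omega> $ r * Y \<omega> $ c \<partial>M)"

text \<open>
  Covariance stationarity.  As the mean is constant, time-invariance of the second moments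
  \<open>E[y\<^sub>t y\<^sub>t\<^sub>-\<^sub>r']\<close> is the same as time-invariance of the autocovariances.
\<close>

definition stationary_process :: "'a measure \<Rightarrow> nat \<Rightarrow> (int \<Rightarrow> 'a \<Rightarrow> real vec) \<Rightarrow> bool" where
  "stationary_process M n y \<longleftrightarrow>
     (\<forall>t. sq_integrable_rvec M n (y t)) \<and>
     (\<forall>s t. mean_vec M n (y s) = mean_vec M n (y t)) \<and>
     (\<forall>s t. \<forall>r::nat. cross_moment M n (y s) (y (s - int r)) = cross_moment M n (y t) (y (t - int r)))"

locale structural_varma = prob_space M
  for M :: "'a measure" +
  fixes K l q :: nat
    and A Psi :: "nat \<Rightarrow> real mat"
    and y eps :: "int \<Rightarrow> 'a \<Rightarrow> real vec"
  assumes K_pos: "K \<ge> 1"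
    and A_carrier: "\<And>i. i \<le> l \<Longrightarrow> A i \<in> carrier_mat K K"
    and Psi_carrier: "\<And>j. j \<in> {1..q} \<Longrightarrow> Psi j \<in> carrier_mat K K"
    and A0_nonsingular: "invertible_mat (A 0)"
    and eps_sq_integrable: "\<And>t. sq_integrable_rvec M K (eps t)"
    and eps_mean: "\<And>t. mean_vec M K (eps t) = 0\<^sub>v K"
    and eps_var: "\<And>t. cross_moment M K (eps t) (eps t) = 1\<^sub>m K"
    and eps_uncorrelated:
      "\<And>t r. r \<ge> 1 \<Longrightarrow> cross_moment M K (eps t) (eps (t - int r)) = 0\<^sub>m K K"
    and y_stationary: "stationary_process M K y"
    and varma: "\<And>t. AE \<omega> in M. A 0 *\<^sub>v y t \<omega> =
        finsum_vec TYPE(real) K (\<lambda>i. A i *\<^sub>v y (t - int i) \<omega>) {1..l} +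
        finsum_vec TYPE(real) K (\<lambda>j. Psi j *\<^sub>v eps (t - int j) \<omega>) {1..q} +
        eps t \<omega>"

section \<open>Systems form\<close>

definition A_star :: "nat \<Rightarrow> nat \<Rightarrow> (nat \<Rightarrow> real mat) \<Rightarrow> real mat \<Rightarrow> nat \<Rightarrow> real mat" where
  "A_star K l A T i = (if i \<le> l then A i * transpose_mat T else 0\<^sub>m K K)"

definition Psi_ext :: "nat \<Rightarrow> nat \<Rightarrow> (nat \<Rightarrow> real mat) \<Rightarrow> nat \<Rightarrow> real mat" where
  "Psi_ext K q Psi j = (if j \<le> q then Psi j else 0\<^sub>m K K)"

text \<open>
  The arguments \<open>As\<close>, \<open>Ps\<close> are the zero-extended coefficient sequences and \<open>Q\<close>, \<open>L\<close>
  the QL-factors of \<open>As 0\<close>.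
\<close>

definition systems_B ::
    "nat \<Rightarrow> nat \<Rightarrow> (nat \<Rightarrow> real mat) \<Rightarrow> real mat \<Rightarrow> real mat \<Rightarrow> real mat" where
  "systems_B K h As Q L =
     (let D = mat_inv (diag_part L) in
      block_matrix K h (\<lambda>a b.
        if a = b then 1\<^sub>m K - D * L
        else if b < a then D * transpose_mat Q * As (a - b)
        else 0\<^sub>m K K))"

definition systems_Omega ::
    "nat \<Rightarrow> nat \<Rightarrow> (nat \<Rightarrow> real mat) \<Rightarrow> real mat \<Rightarrow> real mat \<Rightarrow> real mat" where
  "systems_Omega K h Ps Q L =
     (let D = mat_inv (diag_part L) in
      block_matrix K h (\<lambda>a b.
        if a = b then D * transpose_mat Q
        else if b < a then D * transpose_mat Q * Ps (a - b)
        else 0\<^sub>m K K))"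

text \<open>The stacked shocks \<open>(\<epsilon>\<^sub>t', \<dots>, \<epsilon>\<^sub>t\<^sub>+\<^sub>h')'\<close>.\<close>

definition stacked_shocks ::
    "nat \<Rightarrow> nat \<Rightarrow> (int \<Rightarrow> 'a \<Rightarrow> real vec) \<Rightarrow> int \<Rightarrow> 'a \<Rightarrow> real vec" where
  "stacked_shocks K h eps t \<omega> =
     vec ((h + 1) * K) (\<lambda>r. eps (t + int (r div K)) \<omega> $ (r mod K))"

definition impulse_response :: "real mat \<Rightarrow> real mat \<Rightarrow> real mat" where
  "impulse_response B Om = mat_inv (1\<^sub>m (dim_row B) - B) * Om"

section \<open>The induced graph and path-specific effects\<close>

datatype node = Shock nat | Var nat

type_synonym edge = "node \<times> node"

definition systems_graph :: "nat \<Rightarrow> real mat \<Rightarrow> real mat \<Rightarrow> (node, edge) pre_digraph" where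
  "systems_graph K B Om =
     \<lparr>verts = Shock ` {1..K} \<union> Var ` {1..dim_row B},
      arcs = {(Var m, Var n) | m n. m \<in> {1..dim_row B} \<and> n \<in> {1..dim_row B} \<and> entry B n m \<noteq> 0}
           \<union> {(Shock i, Var n) | i n. i \<in> {1..K} \<and> n \<in> {1..dim_row B} \<and> entry Om n i \<noteq> 0},
      tail = fst,
      head = snd\<rparr>"

fun path_coeff :: "real mat \<Rightarrow> real mat \<Rightarrow> edge \<Rightarrow> real" where
  "path_coeff B Om (Var m, Var n) = entry B n m"
| "path_coeff B Om (Shock i, Var n) = entry Om n i"
| "path_coeff B Om (_, Shock _) = 0"

text \<open>Paths are represented by their lists of arcs.\<close>

definition directed_paths :: "('v, 'e) pre_digraph \<Rightarrow> 'v \<Rightarrow> 'v \<Rightarrow> 'e list set" where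
  "directed_paths G u v = {p. pre_digraph.apath G u p v}"

definition path_effect :: "real mat \<Rightarrow> real mat \<Rightarrow> real \<Rightarrow> edge list \<Rightarrow> real" where
  "path_effect B Om \<xi> p = \<xi> * prod_list (map (path_coeff B Om) p)"

definition total_path_effect :: "real mat \<Rightarrow> real mat \<Rightarrow> real \<Rightarrow> edge list set \<Rightarrow> real" where
  "total_path_effect B Om \<xi> P = (\<Sum>p\<in>P. path_effect B Om \<xi> p)"

section \<open>Potential outcomes\<close>

definition eta :: "nat \<Rightarrow> nat" where
  "eta j = 2 ^ (j - 1)"

definition H_idx :: "nat \<Rightarrow> nat" where
  "H_idx j = 2 ^ j - 1"

definition assignments :: "real \<Rightarrow> nat \<Rightarrow> real vec set" where
  "assignments \<xi> j = {e \<in> carrier_vec (eta j). \<forall>r<eta j. e $ r \<in> {0, \<xi>}}"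

definition ones :: "nat \<Rightarrow> real vec" where
  "ones n = vec n (\<lambda>_. 1)"

text \<open>The entries of \<open>e\<close> in the (1-based) positions \<open>H(k-1)+1, \<dots>, H(k)\<close>.\<close>

definition sub_assignment :: "real vec \<Rightarrow> nat \<Rightarrow> real vec" where
  "sub_assignment e k = vec (eta k) (\<lambda>r. ventry e (H_idx (k - 1) + 1 + r))"

text \<open>
  \<open>s\<close> is a realisation of the stacked shocks.
\<close>

fun potential_outcome ::
    "real mat \<Rightarrow> real mat \<Rightarrow> nat \<Rightarrow> real vec \<Rightarrow> nat \<Rightarrow> real vec \<Rightarrow> real" where
  "potential_outcome B Om i s j e =
     (\<Sum>k\<in>{1..<j}. entry B j k * potential_outcome B Om i s k (sub_assignment e k)) +
     entry Om j i * ventry e (eta j) +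
     (\<Sum>m\<in>{1..dim_col Om} - {i}. entry Om j m * ventry s m)"

declare potential_outcome.simps [simp del]

definition causal_effect ::
    "'a measure \<Rightarrow> real mat \<Rightarrow> real mat \<Rightarrow> ('a \<Rightarrow> real vec) \<Rightarrow> nat \<Rightarrow> nat \<Rightarrow> real vec \<Rightarrow> real" where
  "causal_effect M B Om S i j e =
     (\<integral>\<omega>. potential_outcome B Om i (S \<omega>) j e - potential_outcome B Om i (S \<omega>) j (0\<^sub>v (eta j)) \<partial>M)"

end

theory Submission
  imports Defs "Jordan_Normal_Form.Determinant"
begin

text \<open>
  All three quantities obey the forward substitution for \<open>(I - B) f = \<xi> \<Omega>\<^sub>\<bullet>\<^sub>i\<close>, namely
  \<open>f\<^sub>j = \<xi> \<Omega>\<^sub>j\<^sub>i + (\<Sum>k<j. B\<^sub>j\<^sub>k f\<^sub>k)\<close>: a path from the shock to \<open>x\<^sub>j\<close> is either a single edge or a path to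
  some \<open>x\<^sub>k\<close>, \<open>k < j\<close>, followed by the edge \<open>x\<^sub>k \<rightarrow> x\<^sub>j\<close>; and in the difference of potential outcomes
  the other shocks cancel.  As \<open>B\<close> is strictly lower triangular, the solution is unique, which
  gives (i).  (ii) is the splitting of a finite sum along a partition, and (iii) holds because the
  causal effect is additive in the assignment vector.
\<close>

section \<open>Strictly lower triangular systems\<close>

definition strictly_lower :: "real mat \<Rightarrow> bool" where
  "strictly_lower B \<longleftrightarrow> (\<forall>m<dim_row B. \<forall>n<dim_col B. m \<le> n \<longrightarrow> B $$ (m, n) = 0)"

lemma entry_strictly_lower:
  assumes "strictly_lower B" "B \<in> carrier_mat N N" "m \<in> {1..N}" "n \<in> {1..N}" "m \<le> n"
  shows "entry B m n = 0"
  using assms by (auto simp: strictly_lower_def entry_def)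

lemma less_if_entry_nonzero:
  assumes "strictly_lower B" "B \<in> carrier_mat N N" "entry B m n \<noteq> 0" "m \<in> {1..N}" "n \<in> {1..N}"
  shows "n < m"
  using assms entry_strictly_lower[of B N m n] by fastforce

text \<open>A nonzero determinant makes \<open>A\<close> a unit, so \<open>mat_inverse\<close> is
  not \<open>None\<close> and the \<open>the\<close> inside \<open>mat_inv\<close> is
  meaningful.\<close>

lemma mat_inv_inverse:
  assumes A: "A \<in> carrier_mat n n" and "Determinant.det A \<noteq> 0"
  shows "A * mat_inv A = 1\<^sub>m n" "mat_inv A * A = 1\<^sub>m n" "mat_inv A \<in> carrier_mat n n"
proof -
  have "mat_inverse A \<noteq> None"
    using mat_inverse(1)[OF A, where b = "()"] det_non_zero_imp_unit[OF assms, where b = "()"] by blast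
  then have "mat_inverse A = Some (mat_inv A)"
    by (auto simp: mat_inv_def)
  from mat_inverse(2)[OF A this]
  show "A * mat_inv A = 1\<^sub>m n" "mat_inv A * A = 1\<^sub>m n" "mat_inv A \<in> carrier_mat n n"
    by auto
qed

lemma det_one_minus_strictly_lower:
  assumes B: "B \<in> carrier_mat N N" and low: "strictly_lower B"
  shows "Determinant.det (1\<^sub>m N - B) = 1"
proof -
  have "Determinant.det (1\<^sub>m N - B) = prod_list (diag_mat (1\<^sub>m N - B))"
    using assms by (intro det_lower_triangular[of N]) (auto simp: strictly_lower_def)
  also have "\<dots> = 1"
    unfolding prod_list_diag_prod using assms
    by (intro prod.neutral) (auto simp: strictly_lower_def)
  finally show ?thesis .
qed

text \<open>Rearrange \<open>(I - B) F = Om\<close> to \<open>F = Om + B F\<close>; row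
  \<open>j\<close> of \<open>B\<close> vanishes from column \<open>j\<close> on, which truncates the
  sum.\<close>

lemma impulse_response_recursion:
  assumes B: "B \<in> carrier_mat N N" and low: "strictly_lower B" and Om: "Om \<in> carrier_mat N N'"
    and i: "i \<in> {1..N'}" and j: "j \<in> {1..N}"
  shows "entry (impulse_response B Om) j i =
    entry Om j i + (\<Sum>k\<in>{1..<j}. entry B j k * entry (impulse_response B Om) k i)"
proof -
  let ?A = "1\<^sub>m N - B" and ?F = "impulse_response B Om"
  have A: "?A \<in> carrier_mat N N" using B by (rule minus_carrier_mat)
  note inv = mat_inv_inverse[OF A, unfolded det_one_minus_strictly_lower[OF B low], simplified]
  have F_eq: "?F = mat_inv ?A * Om" using B by (simp add: impulse_response_def)
  then have F: "?F \<in> carrier_mat N N'" using inv(3) Om by auto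
  have "?A * ?F = Om"
    unfolding F_eq using assoc_mult_mat[OF A inv(3) Om] inv(1) Om by simp
  then have Om_eq: "Om = ?F - B * ?F"
    using minus_mult_distrib_mat[OF _ B F, of "1\<^sub>m N"] F by simp
  have "entry (B * ?F) j i = (\<Sum>k\<in>{0..<N}. B $$ (j - 1, k) * ?F $$ (k, i - 1))"
    using i j B F by (auto simp: entry_def scalar_prod_def intro!: sum.cong)
  \<comment> \<open>Shift from 0-based matrix indices to the 1-based indices of
    \<open>entry\<close>.\<close>
  also have "\<dots> = (\<Sum>k\<in>{1..N}. entry B j k * entry ?F k i)"
    by (rule sum.reindex_bij_witness[of _ "\<lambda>k. k - 1" Suc]) (auto simp: entry_def)
  also have "\<dots> = (\<Sum>k\<in>{1..<j}. entry B j k * entry ?F k i)"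
    using j entry_strictly_lower[OF low B j] by (intro sum.mono_neutral_right) auto
  finally have "entry (B * ?F) j i = (\<Sum>k\<in>{1..<j}. entry B j k * entry ?F k i)" .
  moreover have "entry Om j i = entry ?F j i - entry (B * ?F) j i"
    using i j B F by (subst Om_eq) (auto simp: entry_def)
  ultimately show ?thesis by simp
qed

lemma forward_substitution_unique:
  assumes B: "B \<in> carrier_mat N N" and low: "strictly_lower B" and Om: "Om \<in> carrier_mat N N'"
    and i: "i \<in> {1..N'}" and j: "j \<in> {1..N}"
    and f: "\<And>j. j \<in> {1..N} \<Longrightarrow> f j = \<xi> * entry Om j i + (\<Sum>k\<in>{1..<j}. entry B j k * f k)"
  shows "f j = \<xi> * entry (impulse_response B Om) j i"
  using j
proof (induction j rule: less_induct)
  case (less j)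
  have "f j = \<xi> * entry Om j i +
      (\<Sum>k\<in>{1..<j}. entry B j k * (\<xi> * entry (impulse_response B Om) k i))"
    using less by (subst f[OF less.prems]) simp
  also have "\<dots> = \<xi> * (entry Om j i + (\<Sum>k\<in>{1..<j}. entry B j k * entry (impulse_response B Om) k i))"
    by (simp add: algebra_simps sum_distrib_left)
  finally show ?case
    using impulse_response_recursion[OF B low Om i less.prems] by simp
qed

section \<open>The systems form\<close>

lemma block_matrix_carrier: "block_matrix K h blk \<in> carrier_mat ((h + 1) * K) ((h + 1) * K)"
  by (simp add: block_matrix_def)

text \<open>If \<open>m <= n\<close>, then either the block row lies strictly before the block
  column, or the two agree and the remainders modulo \<open>K\<close> are ordered like
  \<open>m\<close> and \<open>n\<close>.\<close>

lemma strictly_lower_block_matrix: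
  assumes "\<And>a b r c. a < b \<Longrightarrow> r < K \<Longrightarrow> c < K \<Longrightarrow> blk a b $$ (r, c) = 0"
    and "\<And>a r c. r \<le> c \<Longrightarrow> c < K \<Longrightarrow> blk a a $$ (r, c) = 0"
  shows "strictly_lower (block_matrix K h blk)"
  unfolding strictly_lower_def
proof (intro allI impI)
  fix m n
  assume "m < dim_row (block_matrix K h blk)" "n < dim_col (block_matrix K h blk)"
  then have m: "m < (h + 1) * K" and n: "n < (h + 1) * K"
    by (simp_all add: block_matrix_def)
  then have K: "K > 0" by (cases K) auto
  assume mn: "m \<le> n"
  have "blk (m div K) (n div K) $$ (m mod K, n mod K) = 0"
  proof (cases "m div K = n div K")
    case True
    then have "m mod K \<le> n mod K"
      using mn by (metis div_mult_mod_eq nat_add_left_cancel_le)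
    then show ?thesis using True assms(2) K by simp
  next
    case False
    then have "m div K < n div K" using mn by (simp add: div_le_mono order.not_eq_order_implies_strict)
    then show ?thesis using assms(1) K by simp
  qed
  then show "block_matrix K h blk $$ (m, n) = 0"
    using m n by (simp add: block_matrix_def)
qed

lemma mat_inv_diag_part:
  assumes L: "L \<in> carrier_mat n n" and nz: "\<And>r. r < n \<Longrightarrow> L $$ (r, r) \<noteq> 0"
  shows "mat_inv (diag_part L) = mat_diag n (\<lambda>r. 1 / L $$ (r, r))"
proof -
  let ?\<Delta> = "diag_part L" and ?E = "mat_diag n (\<lambda>r. 1 / L $$ (r, r))"
  have \<Delta>: "?\<Delta> \<in> carrier_mat n n" and \<Delta>_eq: "?\<Delta> = mat_diag n (\<lambda>r. L $$ (r, r))"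
    using L by (auto simp: diag_part_def)
  have "Determinant.det ?\<Delta> = prod_list (diag_mat ?\<Delta>)"
    by (intro det_lower_triangular[OF _ \<Delta>]) (simp add: \<Delta>_eq mat_diag_def)
  also have "\<dots> \<noteq> 0"
    unfolding prod_list_diag_prod using nz by (simp add: \<Delta>_eq mat_diag_def)
  finally have det: "Determinant.det ?\<Delta> \<noteq> 0" .
  note inv = mat_inv_inverse[OF \<Delta> det]
  have one: "?\<Delta> * ?E = 1\<^sub>m n"
    unfolding \<Delta>_eq mat_diag_diag using nz by (auto simp: mat_diag_def intro!: eq_matI)
  \<comment> \<open>By associativity a right inverse coincides with the two-sided inverse.\<close>
  have "mat_inv ?\<Delta> = mat_inv ?\<Delta> * (?\<Delta> * ?E)"
    unfolding one using inv(3) by simp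
  also have "\<dots> = (mat_inv ?\<Delta> * ?\<Delta>) * ?E"
    using assoc_mult_mat[OF inv(3) \<Delta>, of ?E n] by simp
  also have "\<dots> = ?E"
    unfolding inv(2) by (rule left_mult_one_mat[OF mat_diag_dim])
  finally show ?thesis .
qed

text \<open>Row \<open>r\<close> of \<open>D * L\<close> is row \<open>r\<close> of \<open>L\<close>
  divided by \<open>L $$ (r, r)\<close>, so \<open>D * L\<close> is lower triangular with unit
  diagonal and \<open>I - D * L\<close> has zero diagonal.\<close>

lemma strictly_lower_systems_B:
  assumes "ql_decomposition K A Q L"
  shows "strictly_lower (systems_B K h As Q L)"
proof -
  from assms have L: "L \<in> carrier_mat K K" and nz: "\<And>r. r < K \<Longrightarrow> L $$ (r, r) \<noteq> 0"
    and low: "\<And>r c. r < c \<Longrightarrow> c < K \<Longrightarrow> L $$ (r, c) = 0"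
    by (auto simp: ql_decomposition_def)
  have "(1\<^sub>m K - mat_inv (diag_part L) * L) $$ (r, c) = 0" if "r \<le> c" "c < K" for r c
    using that nz[of r] low[of r c] L
    by (cases "r = c") (auto simp: mat_inv_diag_part[OF L nz] mat_diag_mult_left[OF L])
  then show ?thesis
    unfolding systems_B_def Let_def by (intro strictly_lower_block_matrix) auto
qed

section \<open>Path-specific effects\<close>

context pre_digraph
begin

text \<open>\<open>cas\<close> recurses on the first arc, whereas the recursion for path effects
  removes the last one.\<close>

lemma awalk_snoc_iff:
  "awalk u (p @ [a]) v \<longleftrightarrow> awalk u p (tail G a) \<and> a \<in> arcs G \<and> head G a = v"
proof -
  have "cas u (p @ [a]) v \<longleftrightarrow> cas u p (tail G a) \<and> head G a = v"
    by (induction p arbitrary: u) auto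
  then show ?thesis by (auto simp: awalk_def)
qed

lemma apath_iff_awalk_if_ranked:
  fixes rank :: "'a \<Rightarrow> 'c::preorder"
  assumes rank: "\<And>a. a \<in> arcs G \<Longrightarrow> rank (tail G a) < rank (head G a)"
  shows "apath u p v \<longleftrightarrow> awalk u p v"
proof -
  \<comment> \<open>Arcs strictly raise the rank, so no vertex recurs. The rank bound strengthens
    the induction: it keeps a prepended vertex strictly below all later ones.\<close>
  have "distinct (awalk_verts u p) \<and> (\<forall>w\<in>set (awalk_verts u p). rank u \<le> rank w)"
    if "cas u p v" "set p \<subseteq> arcs G"
    using that
  proof (induction p arbitrary: u)
    case (Cons a p)
    then have IH: "distinct (awalk_verts (head G a) p)"
        "\<forall>w\<in>set (awalk_verts (head G a) p). rank (head G a) \<le> rank w"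
      and u: "u = tail G a" and less: "rank u < rank (head G a)"
      using rank[of a] by auto
    have "rank u < rank w" if "w \<in> set (awalk_verts (head G a) p)" for w
      using IH(2) that less less_le_trans by blast
    then show ?case using IH(1) u by (auto intro: less_imp_le)
  qed auto
  then show ?thesis by (auto simp: apath_def awalk_def)
qed

end

text \<open>Variables are numbered from 1, so rank 0 puts every shock strictly below them.\<close>

primrec node_rank :: "node \<Rightarrow> nat" where
  "node_rank (Shock _) = 0"
| "node_rank (Var n) = n"

lemma mem_directed_paths_iff:
  assumes "B \<in> carrier_mat N N" "strictly_lower B"
  shows "p \<in> directed_paths (systems_graph K B Om) u v \<longleftrightarrow>
    pre_digraph.awalk (systems_graph K B Om) u p v"
proof -
  let ?G = "systems_graph K B Om"
  have "node_rank (tail ?G a) < node_rank (head ?G a)" if "a \<in> arcs ?G" for a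
    using that assms(1) less_if_entry_nonzero[OF assms(2,1)]
    by (auto simp: systems_graph_def)
  then show ?thesis
    by (simp add: directed_paths_def pre_digraph.apath_iff_awalk_if_ranked[of _ node_rank])
qed

text \<open>Split on the tail of the last arc. Since walks and paths coincide here, extending a path
  by an arc needs no check that its vertices stay distinct.\<close>

lemma directed_paths_Shock_Var:
  assumes B: "B \<in> carrier_mat N N" and low: "strictly_lower B"
    and i: "i \<in> {1..K}" and j: "j \<in> {1..N}"
  shows "directed_paths (systems_graph K B Om) (Shock i) (Var j) =
    (if entry Om j i = 0 then {} else {[(Shock i, Var j)]}) \<union>
    (\<Union>k\<in>{k \<in> {1..<j}. entry B j k \<noteq> 0}.
      (\<lambda>p. p @ [(Var k, Var j)]) ` directed_paths (systems_graph K B Om) (Shock i) (Var k))"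
    (is "?P j = ?R")
proof (rule Set.set_eqI)
  fix p
  let ?G = "systems_graph K B Om"
  note mem = mem_directed_paths_iff[OF B low] and snoc = pre_digraph.awalk_snoc_iff
  show "p \<in> ?P j \<longleftrightarrow> p \<in> ?R"
  proof (cases p rule: rev_cases)
    case Nil
    then show ?thesis by (auto simp: mem pre_digraph.awalk_def pre_digraph.cas.simps)
  next
    case (snoc p' a)
    obtain u v where a: "a = (u, v)" by (cases a)
    have p: "p \<in> ?P j \<longleftrightarrow> pre_digraph.awalk ?G (Shock i) p' u \<and> a \<in> arcs ?G \<and> v = Var j"
      by (simp add: mem snoc pre_digraph.awalk_snoc_iff a) (simp add: systems_graph_def)
    show ?thesis
    proof (cases u)
      case (Shock i')
      \<comment> \<open>No arc ends in a shock, so only the empty walk reaches one.\<close>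
      have "pre_digraph.awalk ?G (Shock i) p' (Shock i') \<longleftrightarrow> p' = [] \<and> i' = i"
      proof (cases p' rule: rev_cases)
        case Nil
        then show ?thesis
          using i by (auto simp: pre_digraph.awalk_def pre_digraph.cas.simps systems_graph_def)
      next
        case (snoc p'' b)
        then show ?thesis
          by (auto simp: pre_digraph.awalk_snoc_iff) (auto simp: systems_graph_def)
      qed
      then show ?thesis
        using i j B unfolding p by (auto simp: snoc a Shock systems_graph_def)
    next
      case (Var k)
      have "a \<in> arcs ?G \<and> v = Var j \<longleftrightarrow> k \<in> {1..<j} \<and> entry B j k \<noteq> 0 \<and> v = Var j"
        using j B less_if_entry_nonzero[OF low B _ j, of k]
        by (auto simp: a Var systems_graph_def)
      then show ?thesis
        unfolding p by (auto simp: snoc a Var mem)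
    qed
  qed
qed

text \<open>Path effects are sums over sets of paths, and splitting such sums below relies on
  finiteness.\<close>

lemma finite_directed_paths_Shock_Var:
  assumes B: "B \<in> carrier_mat N N" and low: "strictly_lower B"
    and i: "i \<in> {1..K}" and j: "j \<in> {1..N}"
  shows "finite (directed_paths (systems_graph K B Om) (Shock i) (Var j))"
  using j
proof (induction j rule: less_induct)
  case (less j)
  then show ?case
    by (subst directed_paths_Shock_Var[OF B low i less.prems]) auto
qed

lemma total_path_effect_recursion:
  fixes Om :: "real mat"
  assumes B: "B \<in> carrier_mat N N" and low: "strictly_lower B"
    and i: "i \<in> {1..K}" and j: "j \<in> {1..N}"
  defines "P \<equiv> \<lambda>j::nat. directed_paths (systems_graph K B Om) (Shock i) (Var j)"
  shows "total_path_effect B Om \<xi> (P j) =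
    \<xi> * entry Om j i + (\<Sum>k\<in>{1..<j}. entry B j k * total_path_effect B Om \<xi> (P k))"
proof -
  let ?w = "path_effect B Om \<xi>"
  let ?S = "if entry Om j i = 0 then {} else {[(Shock i, Var j)]}"
  let ?E = "\<lambda>k p. p @ [(Var k, Var j)]"
  let ?I = "{k \<in> {1..<j}. entry B j k \<noteq> 0}"
  have fin: "finite (P k)" if "k \<in> {1..<j}" for k
    using finite_directed_paths_Shock_Var[OF B low i, of k] that j by (simp add: P_def)
  have "[] \<notin> P k" for k
    by (auto simp: P_def mem_directed_paths_iff[OF B low] pre_digraph.awalk_def pre_digraph.cas.simps)
  then have "sum ?w (P j) = sum ?w ?S + sum ?w (\<Union>k\<in>?I. ?E k ` P k)"
    unfolding P_def directed_paths_Shock_Var[OF B low i j]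
    using fin by (intro sum.union_disjoint) (auto simp: P_def)
  \<comment> \<open>The images are disjoint because the last arc determines
    \<open>k\<close>.\<close>
  also have "sum ?w (\<Union>k\<in>?I. ?E k ` P k) = (\<Sum>k\<in>?I. sum ?w (?E k ` P k))"
    using fin by (intro sum.UNION_disjoint) auto
  also have "\<dots> = (\<Sum>k\<in>?I. entry B j k * sum ?w (P k))"
    by (intro sum.cong refl)
      (simp add: sum.reindex inj_on_def sum_distrib_left path_effect_def mult_ac)
  \<comment> \<open>Missing arcs are exactly those with coefficient 0, so their terms can be
    restored; the same settles the direct arc.\<close>
  also have "\<dots> = (\<Sum>k\<in>{1..<j}. entry B j k * sum ?w (P k))"
    by (intro sum.mono_neutral_left) auto
  also have "sum ?w ?S = \<xi> * entry Om j i"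
    by (simp add: path_effect_def)
  finally show ?thesis by (simp add: total_path_effect_def)
qed

section \<open>Causal effects\<close>

text \<open>The part of \<open>potential_outcome\<close> that is linear in the assignment, free of
  the realised shocks.\<close>

fun nested_effect :: "real mat \<Rightarrow> real mat \<Rightarrow> nat \<Rightarrow> nat \<Rightarrow> real vec \<Rightarrow> real" where
  "nested_effect B Om i j e =
     (\<Sum>k\<in>{1..<j}. entry B j k * nested_effect B Om i k (sub_assignment e k)) +
     entry Om j i * ventry e (eta j)"

declare nested_effect.simps [simp del]

text \<open>In 0-based positions slice \<open>k\<close> ends at \<open>2^k - 2\<close>, which is
  below \<open>2^(j-1) - 1\<close>, the position of the direct-effect entry. Slices thus stay inside
  the vector.\<close>

lemma H_idx_less_eta:
  assumes "k \<in> {1..<j}" "r < eta k"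
  shows "H_idx (k - 1) + r < eta j"
proof -
  have "2 ^ k \<le> (2::nat) ^ (j - 1)" using assms(1) by (intro power_increasing) auto
  moreover have "2 ^ k = 2 * (2::nat) ^ (k - 1)" using assms(1) by (cases k) auto
  ultimately show ?thesis using assms(2) by (simp add: H_idx_def eta_def)
qed

lemma sub_assignment_index:
  assumes "r < eta k"
  shows "sub_assignment e k $ r = e $ (H_idx (k - 1) + r)"
  using assms by (simp add: sub_assignment_def ventry_def)

lemma sub_assignment_const:
  assumes "k \<in> {1..<j}"
  shows "sub_assignment (c \<cdot>\<^sub>v ones (eta j)) k = c \<cdot>\<^sub>v ones (eta k)"
proof (rule eq_vecI)
  show "dim_vec (sub_assignment (c \<cdot>\<^sub>v ones (eta j)) k) = dim_vec (c \<cdot>\<^sub>v ones (eta k))"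
    by (simp add: sub_assignment_def ones_def)
qed (use H_idx_less_eta[OF assms] in \<open>auto simp: sub_assignment_index ones_def\<close>)

lemma zero_vec_eq_smult_ones: "0\<^sub>v n = (0::real) \<cdot>\<^sub>v ones n"
  by (rule eq_vecI) (auto simp: ones_def)

lemma potential_outcome_diff:
  "potential_outcome B Om i s j e - potential_outcome B Om i s j (0\<^sub>v (eta j)) =
    nested_effect B Om i j e"
proof (induction j arbitrary: e rule: less_induct)
  case (less j)
  \<comment> \<open>Slices of the zero assignment are zero assignments, so the induction hypothesis
    fits each subtracted term.\<close>
  have "sub_assignment (0\<^sub>v (eta j)) k = 0\<^sub>v (eta k)" if "k \<in> {1..<j}" for k
    using sub_assignment_const[OF that, of 0] by (simp add: zero_vec_eq_smult_ones)
  moreover have "ventry (0\<^sub>v (eta j)) (eta j) = 0"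
    by (simp add: ventry_def eta_def)
  ultimately show ?case
    by (simp add: potential_outcome.simps[of _ _ _ _ j] nested_effect.simps[of _ _ _ j]
        less.IH[symmetric] sum_subtractf right_diff_distrib)
qed

text \<open>The integrand does not depend on the outcome, and a constant integrates to itself over a
  probability space.\<close>

lemma (in prob_space) causal_effect_eq_nested_effect:
  "causal_effect M B Om S i j e = nested_effect B Om i j e"
  by (simp add: causal_effect_def potential_outcome_diff prob_space)

lemma nested_effect_const:
  "nested_effect B Om i j (\<xi> \<cdot>\<^sub>v ones (eta j)) = \<xi> * entry Om j i +
    (\<Sum>k\<in>{1..<j}. entry B j k * nested_effect B Om i k (\<xi> \<cdot>\<^sub>v ones (eta k)))"
proof -
  have "ventry (\<xi> \<cdot>\<^sub>v ones (eta j)) (eta j) = \<xi>"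
    by (simp add: ventry_def ones_def eta_def)
  then show ?thesis
    by (simp add: nested_effect.simps[of _ _ _ j] sub_assignment_const)
qed

text \<open>Slicing acts entrywise and the recursion is linear, so additivity passes from the slices
  to the whole vector. The entrywise hypothesis lets the induction apply directly to slices.\<close>

lemma nested_effect_sum:
  assumes "\<And>r. r < eta j \<Longrightarrow> v $ r = (\<Sum>m\<in>I. e m $ r)"
  shows "nested_effect B Om i j v = (\<Sum>m\<in>I. nested_effect B Om i j (e m))"
  using assms
proof (induction j arbitrary: v e rule: less_induct)
  case (less j)
  have "nested_effect B Om i k (sub_assignment v k) =
      (\<Sum>m\<in>I. nested_effect B Om i k (sub_assignment (e m) k))" if "k \<in> {1..<j}" for k
    using that H_idx_less_eta[OF that]
    by (intro less.IH) (auto simp: sub_assignment_index less.prems)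
  moreover have "ventry v (eta j) = (\<Sum>m\<in>I. ventry (e m) (eta j))"
    unfolding ventry_def by (intro less.prems) (simp add: eta_def)
  ultimately have "nested_effect B Om i j v =
      (\<Sum>k\<in>{1..<j}. \<Sum>m\<in>I. entry B j k * nested_effect B Om i k (sub_assignment (e m) k)) +
      (\<Sum>m\<in>I. entry Om j i * ventry (e m) (eta j))"
    by (simp add: nested_effect.simps[of _ _ _ j] sum_distrib_left)
  then show ?case
    by (simp add: sum.swap[of _ I] nested_effect.simps[of _ _ _ j] sum.distrib)
qed

theorem theorem2:
  fixes M :: "'a measure"
    and K l q h i j k :: nat
    and A Psi :: "nat \<Rightarrow> real mat"
    and T Q L B Om :: "real mat"
    and y eps :: "int \<Rightarrow> 'a \<Rightarrow> real vec"
    and t :: int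
    and \<xi> :: real
    and P :: "nat \<Rightarrow> edge list set"
    and e :: "nat \<Rightarrow> real vec"
  assumes model: "structural_varma M K l q A Psi y eps"
    and T: "permutation_matrix K T"
    and QL: "ql_decomposition K (A_star K l A T 0) Q L"
    and B: "B = systems_B K h (A_star K l A T) Q L"
    and Om: "Om = systems_Omega K h (Psi_ext K q Psi) Q L"
    and i: "i \<in> {1..K}"
    and j: "j \<in> {1..(h + 1) * K}"
    and P_disjoint: "disjoint_family_on P {1..k}"
    and P_cover: "(\<Union>m\<in>{1..k}. P m) = directed_paths (systems_graph K B Om) (Shock i) (Var j)"
    and e_assign: "\<forall>m\<in>{1..k}. e m \<in> assignments \<xi> j"
    and e_sum: "finsum_vec TYPE(real) (eta j) e {1..k} = \<xi> \<cdot>\<^sub>v ones (eta j)"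
  shows
    "(total_path_effect B Om \<xi> (directed_paths (systems_graph K B Om) (Shock i) (Var j))
        = causal_effect M B Om (stacked_shocks K h eps t) i j (\<xi> \<cdot>\<^sub>v ones (eta j))
      \<and> causal_effect M B Om (stacked_shocks K h eps t) i j (\<xi> \<cdot>\<^sub>v ones (eta j))
        = \<xi> * entry (impulse_response B Om) j i)
     \<and> (\<Sum>m=1..k. total_path_effect B Om \<xi> (P m)) = \<xi> * entry (impulse_response B Om) j i
     \<and> (\<Sum>m=1..k. causal_effect M B Om (stacked_shocks K h eps t) i j (e m))
        = \<xi> * entry (impulse_response B Om) j i"
proof -
  interpret structural_varma M K l q A Psi y eps by (rule model)
  let ?N = "(h + 1) * K"
  let ?D = "directed_paths (systems_graph K B Om) (Shock i) (Var j)"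
  let ?R = "\<xi> * entry (impulse_response B Om) j i"
  have Bc: "B \<in> carrier_mat ?N ?N" and Omc: "Om \<in> carrier_mat ?N ?N"
    by (simp_all only: B Om systems_B_def systems_Omega_def Let_def block_matrix_carrier)
  have low: "strictly_lower B"
    unfolding B by (rule strictly_lower_systems_B[OF QL])
  \<comment> \<open>\<open>Om\<close> has a column for each of the stacked shocks; those at time
    \<open>t\<close> are the first \<open>K\<close>.\<close>
  have iN: "i \<in> {1..?N}" using i by auto
  note unique = forward_substitution_unique[OF Bc low Omc iN j]
  have path: "total_path_effect B Om \<xi> ?D = ?R"
    by (rule unique[of "\<lambda>j. total_path_effect B Om \<xi>
        (directed_paths (systems_graph K B Om) (Shock i) (Var j))"])
      (rule total_path_effect_recursion[OF Bc low i])
  have nested: "nested_effect B Om i j (\<xi> \<cdot>\<^sub>v ones (eta j)) = ?R"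
    by (rule unique[of "\<lambda>j. nested_effect B Om i j (\<xi> \<cdot>\<^sub>v ones (eta j))"])
      (rule nested_effect_const)
  have fin: "finite ?D"
    by (rule finite_directed_paths_Shock_Var[OF Bc low i j])
  have "(\<Sum>m=1..k. total_path_effect B Om \<xi> (P m)) = total_path_effect B Om \<xi> (\<Union>m\<in>{1..k}. P m)"
    unfolding total_path_effect_def
  proof (rule sum.UNION_disjoint[symmetric])
    \<comment> \<open>Each part lies in the finite set of all paths.\<close>
    show "\<forall>m\<in>{1..k}. finite (P m)"
      using fin unfolding P_cover[symmetric] by (blast intro: finite_subset)
  qed (use P_disjoint in \<open>auto simp: disjoint_family_on_def\<close>)
  then have parts: "(\<Sum>m=1..k. total_path_effect B Om \<xi> (P m)) = ?R"
    using path by (simp only: P_cover)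
  have "(\<xi> \<cdot>\<^sub>v ones (eta j)) $ r = (\<Sum>m=1..k. e m $ r)" if "r < eta j" for r
    unfolding e_sum[symmetric] using e_assign that
    by (intro index_finsum_vec) (auto simp: assignments_def)
  from nested_effect_sum[OF this, where B = B and Om = Om and i = i] nested
  have "(\<Sum>m=1..k. nested_effect B Om i j (e m)) = ?R" by simp
  with path nested parts show ?thesis
    by (simp only: causal_effect_eq_nested_effect simp_thms)
qed

end
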